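(* For any tree $T$ and any graph $G$ without odd cycles, $$\gamma_{rdR}(P_2\times T)=2\gamma_{rdR}(T)<\gamma_{rdR}(P_2)\cdot\gamma_{rdR}(T),$$ $$\gamma_{rdR}(P_2\times G)=2\gamma_{rdR}(G)<\gamma_{rdR}(P_2)\cdot\gamma_{rdR}(G).$$
   Context: Graphs are finite, simple and have at least one vertex. A restrained double Roman dominating function (RDRD-function) of a graph $G$ is a function $f:V(G)\to\{0,1,2,3\}$ such that: (i) if $f(v)=0$, then $v$ has at least two neighbours assigned 2 under $f$ or at least one neighbour assigned 3; (ii) if $f(v)=1$, then $v$ has a neighbour $u$ with $f(u)\ge 2$; (iii) the subgraph of $G$ induced by the vertices assigned 0 contains no isolated vertex. The weight of $f$ is $\sum_{v\in V(G)}f(v)$, and $\gamma_{rdR}(G)$ is the minimum weight of an RDRD-function of $G$. $P_2$ is the path on 2 vertices. The cardinal (direct) product $G\times H$ has vertex set $V(G)\times V(H)$, with $(u,v)(u',v')$ an edge iff $uu'\in E(G)$ and $vv'\in E(H)$. *)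

theory Defs
  imports "Graph_Theory.Graph_Theory"
begin

(* An undirected graph is a finite symmetric loop-free pair digraph: the edge uv is
   represented by the two arcs (u, v) and (v, u). *)
definition simple_graph :: "'a pair_pre_digraph \<Rightarrow> bool" where
  "simple_graph G \<longleftrightarrow> pair_graph G \<and> pverts G \<noteq> {}"

(* In a symmetric digraph the library notion of a cycle also covers the closed walks u, v, u
   of length 2; undirected cycles have length at least 3. For the same reason the library
   predicates forest and tree, which exclude these closed walks, hold only for edgeless
   symmetric digraphs and cannot be used here. *)
definition undirected_cycle :: "'a pair_pre_digraph \<Rightarrow> ('a \<times> 'a) awalk \<Rightarrow> bool" where
  "undirected_cycle G p \<longleftrightarrow> pre_digraph.cycle (with_proj G) p \<and> 3 \<le> length p"

definition undirected_tree :: "'a pair_pre_digraph \<Rightarrow> bool" where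
  "undirected_tree G \<longleftrightarrow>
     simple_graph G \<and> connected (with_proj G) \<and> (\<nexists>p. undirected_cycle G p)"

definition without_odd_cycles :: "'a pair_pre_digraph \<Rightarrow> bool" where
  "without_odd_cycles G \<longleftrightarrow> (\<nexists>p. undirected_cycle G p \<and> odd (length p))"

definition neighbours :: "('a, 'b) pre_digraph \<Rightarrow> 'a \<Rightarrow> 'a set" where
  "neighbours H v = {u. v \<rightarrow>\<^bsub>H\<^esub> u}"

definition isolated_vertex :: "('a, 'b) pre_digraph \<Rightarrow> 'a \<Rightarrow> bool" where
  "isolated_vertex H v \<longleftrightarrow> v \<in> verts H \<and> neighbours H v = {}"

(* Only the values of f on the vertices of G matter. *)
definition rdrd_function :: "'a pair_pre_digraph \<Rightarrow> ('a \<Rightarrow> nat) \<Rightarrow> bool" where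
  "rdrd_function G f \<longleftrightarrow>
     (\<forall>v \<in> pverts G. f v \<in> {0, 1, 2, 3}) \<and>
     (\<forall>v \<in> pverts G. f v = 0 \<longrightarrow>
        2 \<le> card {u \<in> neighbours (with_proj G) v. f u = 2} \<or>
        (\<exists>u \<in> neighbours (with_proj G) v. f u = 3)) \<and>
     (\<forall>v \<in> pverts G. f v = 1 \<longrightarrow> (\<exists>u \<in> neighbours (with_proj G) v. 2 \<le> f u)) \<and>
     (\<nexists>v. isolated_vertex (with_proj G \<restriction> {w \<in> pverts G. f w = 0}) v)"

definition weight :: "'a pair_pre_digraph \<Rightarrow> ('a \<Rightarrow> nat) \<Rightarrow> nat" where
  "weight G f = (\<Sum>v \<in> pverts G. f v)"

definition rdrd_number :: "'a pair_pre_digraph \<Rightarrow> nat" where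
  "rdrd_number G = (LEAST w. \<exists>f. rdrd_function G f \<and> weight G f = w)"

(* The minimum defining rdrd_number is over a nonempty set. *)
lemma rdrd_function_const_2: "rdrd_function G (\<lambda>_. 2)"
  by (simp add: rdrd_function_def isolated_vertex_def)

lemma rdrd_number_attained: "\<exists>f. rdrd_function G f \<and> weight G f = rdrd_number G"
  unfolding rdrd_number_def by (rule LeastI_ex) (use rdrd_function_const_2 in blast)

lemma rdrd_number_le: "rdrd_function G f \<Longrightarrow> rdrd_number G \<le> weight G f"
  unfolding rdrd_number_def by (rule Least_le) blast

definition path_graph :: "nat \<Rightarrow> nat pair_pre_digraph" where
  "path_graph n = \<lparr> pverts = {..<n},
     parcs = {(i, j). i < n \<and> j < n \<and> (j = Suc i \<or> i = Suc j)} \<rparr>"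

definition direct_product ::
  "'a pair_pre_digraph \<Rightarrow> 'b pair_pre_digraph \<Rightarrow> ('a \<times> 'b) pair_pre_digraph" where
  "direct_product G H = \<lparr> pverts = pverts G \<times> pverts H,
     parcs = {((u, v), (u', v')). (u, u') \<in> parcs G \<and> (v, v') \<in> parcs H} \<rparr>"

end

theory Submission
  imports Defs
begin

text \<open>
  The projection \<open>snd\<close> from \<open>P\<^sub>2 \<times> G\<close> to \<open>G\<close> maps the neighbourhood of each vertex bijectively
  onto the neighbourhood of its image (it is the bipartite double cover of \<open>G\<close>). The conditions
  on an RDRD-function only look at a vertex and its neighbourhood, so such functions can be pulled
  back along any map with this property (\<open>rdrd_function_pullback\<close>). Pulling back along the
  projection doubles the weight, which gives \<open>\<gamma>(P\<^sub>2 \<times> G) \<le> 2 \<gamma>(G)\<close> for every graph.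

  If \<open>G\<close> has no odd cycle, it has a proper 2-colouring (\<open>two_colouring\<close>), and the double cover
  falls apart into two copies of \<open>G\<close>: one consists of the vertices \<open>(i, v)\<close> in which \<open>i\<close> is the
  colour of \<open>v\<close>, the other one of the remaining vertices. The two embeddings of \<open>G\<close> as one of these
  copies are again bijective on neighbourhoods. An RDRD-function of \<open>P\<^sub>2 \<times> G\<close> thus restricts
  to two RDRD-functions of \<open>G\<close>, whose weights add up to its own, and \<open>2 \<gamma>(G) \<le> \<gamma>(P\<^sub>2 \<times> G)\<close>.

  The strict inequalities say no more than \<open>\<gamma>(P\<^sub>2) > 2\<close> and \<open>\<gamma>(G) > 0\<close>. A tree has no cycle
  at all, so it is a special case of a graph without odd cycles.
\<close>

section \<open>Graphs without odd cycles are 2-colourable\<close>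

text \<open>
  A closed walk that is not a cycle splits at a repeated vertex into two shorter closed walks, and
  one of the two has odd length. Being odd, the final cycle is not one of the closed walks
  \<open>u, v, u\<close>, and it is not of length 1 because there are no loops.
\<close>
lemma odd_closed_walk_imp_odd_cycle:
  assumes "pair_graph G" and "pre_digraph.awalk (with_proj G) u p u" and "odd (length p)"
  shows "\<exists>q. undirected_cycle G q \<and> odd (length q)"
  using assms(2,3)
proof (induction "length p" arbitrary: u p rule: less_induct)
  case less
  interpret pair_graph G by fact
  obtain e es where p: "p = e # es"
    using less.prems(2) by (cases p) auto
  have e: "e \<in> parcs G" "fst e = u" and es: "awalk (snd e) es u"
    using less.prems(1) by (auto simp: p awalk_Cons_iff)
  show ?case
  proof (cases "distinct (awalk_verts (snd e) es)")
    case True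
    have "cycle p"
      unfolding cycle_def using less.prems(1) True p by (intro exI[of _ u]) auto
    moreover have "es \<noteq> []"
      using e es pair_no_loops[of e] by (auto simp: awalk_Nil_iff)
    then have "3 \<le> length p"
      using less.prems(2) p by (cases es; cases "tl es") auto
    ultimately show ?thesis
      using less.prems(2) by (auto simp: undirected_cycle_def)
  next
    case False
    then obtain q r s w where es_eq: "es = q @ r @ s" and "closed_w r"
      and q: "awalk (snd e) q w" and r: "awalk w r w" and s: "awalk w s u"
      using awalk_cyc_decompE'[OF es False] by metis
    have "r \<noteq> []"
      using \<open>closed_w r\<close> by (auto simp: closed_w_def)
    show ?thesis
    proof (cases "odd (length r)")
      case True
      then show ?thesis
        using less.hyps[OF _ r] by (simp add: p es_eq)
    next
      case False
      have "awalk u (e # q @ s) u"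
        using e q s by (auto simp: awalk_Cons_iff)
      then show ?thesis
        using less.hyps[of "e # q @ s" u] less.prems(2) False \<open>r \<noteq> []\<close> by (simp add: p es_eq)
    qed
  qed
qed

text \<open>
  Each vertex is coloured by the parity of a walk to it from a fixed root of its component. Adjacent
  vertices of equal colour would close up two walks of equal parity from the root and the
  edge between the vertices to a closed walk of odd length.
\<close>
lemma two_colouring:
  assumes "pair_graph G" and "without_odd_cycles G"
  obtains c :: "'a \<Rightarrow> bool" where "\<And>u v. (u, v) \<in> parcs G \<Longrightarrow> c u \<noteq> c v"
proof -
  interpret pair_graph G by fact
  have no_odd: "even (length p)" if "awalk u p u" for u p
    using odd_closed_walk_imp_odd_cycle[OF assms(1) that] assms(2)
    by (auto simp: without_odd_cycles_def)
  define root where "root v = (SOME r. \<exists>p. awalk r p v)" for v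
  define c where "c v \<longleftrightarrow> (\<exists>p. awalk (root v) p v \<and> odd (length p))" for v
  have root_walk: "\<exists>p. awalk (root v) p v" if "v \<in> pverts G" for v
    unfolding root_def 
    by (rule someI[of _ v], rule exI[of _ "[]"]) (use that in \<open>simp add: awalk_Nil_iff\<close>)
  have extend: "awalk r (p @ [(u, v)]) v" if "awalk r p u" "(u, v) \<in> parcs G" for r p u v
    using that in_arcsD2[OF that(2)] by (auto simp: awalk_simps)
  \<comment> \<open>As the root depends only on the set of vertices that reach \<open>v\<close>, it is the same for neighbours.\<close>
  have root_eq: "root u = root v" if "(u, v) \<in> parcs G" for u v
  proof -
    have "(\<exists>p. awalk r p u) \<longleftrightarrow> (\<exists>p. awalk r p v)" for r
      using extend that arcs_symmetric[OF that] by blast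
    then show ?thesis
      unfolding root_def by simp
  qed
  have parity: "odd (length p) \<longleftrightarrow> c v" if "awalk (root v) p v" for p v
  proof -
    have "even (length p) \<longleftrightarrow> even (length q)" if "awalk (root v) q v" for q
    proof -
      have "awalk (root v) (p @ rev_path q) (root v)"
        using \<open>awalk (root v) p v\<close> that by auto
      moreover have "length (rev_path q) = length q"
        by (induction q) auto
      ultimately show ?thesis
        using no_odd[of "root v" "p @ rev_path q"] by simp
    qed
    then show ?thesis
      using that unfolding c_def by blast
  qed
  have "c u \<noteq> c v" if uv: "(u, v) \<in> parcs G" for u v
  proof -
    obtain p where p: "awalk (root u) p u"
      using root_walk in_arcsD1[OF uv] by blast
    have "awalk (root v) (p @ [(u, v)]) v"
      using extend[OF p uv] root_eq[OF uv] by simp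
    from parity[OF this] parity[OF p] show ?thesis
      by auto
  qed
  then show thesis
    by (rule that)
qed

section \<open>Pulling back RDRD-functions\<close>

lemma neighbours_with_proj: "neighbours (with_proj G) v = {u. (v, u) \<in> parcs G}"
  by (simp add: neighbours_def)

lemma neighbours_subset_pverts:
  "pair_wf_digraph G \<Longrightarrow> neighbours (with_proj G) v \<subseteq> pverts G"
  by (auto simp: neighbours_with_proj dest: pair_wf_digraph.in_arcsD2)

lemma no_isolated_zero_iff:
  assumes "pair_wf_digraph G"
  shows "(\<nexists>v. isolated_vertex (with_proj G \<restriction> {w \<in> pverts G. f w = 0}) v) \<longleftrightarrow>
    (\<forall>v \<in> pverts G. f v = 0 \<longrightarrow> (\<exists>u \<in> neighbours (with_proj G) v. f u = 0))"
proof -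
  have "neighbours (with_proj G \<restriction> {w \<in> pverts G. f w = 0}) v =
      {u \<in> neighbours (with_proj G) v. f u = 0}" if "v \<in> pverts G" "f v = 0" for v
    using that pair_wf_digraph.in_arcsD2[OF assms]
    by (force simp: neighbours_def arcs_ends_conv induce_subgraph_def)
  then show ?thesis
    by (auto simp: isolated_vertex_def)
qed

lemma rdrd_function_zeroD:
  assumes "rdrd_function G f" and "v \<in> pverts G" and "f v = 0"
  shows "2 \<le> card {u \<in> neighbours (with_proj G) v. f u = 2} \<or>
    (\<exists>u \<in> neighbours (with_proj G) v. f u = 3)"
  using assms by (simp add: rdrd_function_def)

lemma rdrd_function_zero_neighbour:
  assumes "pair_wf_digraph G" and "rdrd_function G f" and "v \<in> pverts G" and "f v = 0"
  shows "\<exists>u \<in> neighbours (with_proj G) v. f u = 0"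
  using assms(2-4) unfolding rdrd_function_def no_isolated_zero_iff[OF assms(1)] by simp

lemma rdrd_function_oneD:
  assumes "rdrd_function G f" and "v \<in> pverts G" and "f v = 1"
  shows "\<exists>u \<in> neighbours (with_proj G) v. 2 \<le> f u"
  using assms by (simp add: rdrd_function_def)

text \<open>
  Each condition on an RDRD-function at a vertex \<open>v\<close> counts neighbours of \<open>v\<close> with a certain value,
  and \<open>\<phi>\<close> preserves these numbers.
\<close>
lemma rdrd_function_pullback:
  assumes G: "pair_wf_digraph G" and H: "pair_wf_digraph H"
    and verts: "\<And>v. v \<in> pverts G \<Longrightarrow> \<phi> v \<in> pverts H"
    and nbrs: "\<And>v. v \<in> pverts G \<Longrightarrow>
      bij_betw \<phi> (neighbours (with_proj G) v) (neighbours (with_proj H) (\<phi> v))"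
    and f: "rdrd_function H f"
  shows "rdrd_function G (f \<circ> \<phi>)"
proof -
  have image: "neighbours (with_proj H) (\<phi> v) = \<phi> ` neighbours (with_proj G) v"
    if "v \<in> pverts G" for v
    using bij_betw_imp_surj_on[OF nbrs[OF that]] by simp
  have card: "card {u \<in> neighbours (with_proj G) v. f (\<phi> u) = 2} =
      card {u \<in> neighbours (with_proj H) (\<phi> v). f u = 2}" if "v \<in> pverts G" for v
  proof (rule bij_betw_same_card[of \<phi>])
    show "bij_betw \<phi> {u \<in> neighbours (with_proj G) v. f (\<phi> u) = 2}
        {u \<in> neighbours (with_proj H) (\<phi> v). f u = 2}"
      using nbrs[OF that] by (auto simp: bij_betw_def inj_on_def)
  qed
  have "f (\<phi> v) \<in> {0, 1, 2, 3} \<and>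
      (f (\<phi> v) = 0 \<longrightarrow> 2 \<le> card {u \<in> neighbours (with_proj G) v. f (\<phi> u) = 2} \<or>
        (\<exists>u \<in> neighbours (with_proj G) v. f (\<phi> u) = 3)) \<and>
      (f (\<phi> v) = 1 \<longrightarrow> (\<exists>u \<in> neighbours (with_proj G) v. 2 \<le> f (\<phi> u))) \<and>
      (f (\<phi> v) = 0 \<longrightarrow> (\<exists>u \<in> neighbours (with_proj G) v. f (\<phi> u) = 0))"
    if v: "v \<in> pverts G" for v
    using bspec[OF f[unfolded rdrd_function_def no_isolated_zero_iff[OF H],
      folded ball_conj_distrib] verts[OF v]]
    unfolding card[OF v] by (simp add: image[OF v])
  then show ?thesis
    unfolding rdrd_function_def no_isolated_zero_iff[OF G] comp_def by blast
qed

section \<open>The product with the path on two vertices\<close>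

lemma parcs_path_2: "(i, j) \<in> parcs (path_graph 2) \<longleftrightarrow> i < 2 \<and> j = 1 - i"
  unfolding path_graph_def by simp presburger

lemma pverts_product_path_2:
  "pverts (direct_product (path_graph 2) G) = {0, 1} \<times> pverts G"
  by (auto simp: direct_product_def path_graph_def)

lemma neighbours_product_path_2:
  assumes "i < 2"
  shows "neighbours (with_proj (direct_product (path_graph 2) G)) (i, v) =
    {1 - i} \<times> neighbours (with_proj G) v"
  using assms unfolding neighbours_with_proj
  by (auto simp: direct_product_def parcs_path_2)

lemma pair_wf_digraph_product_path_2:
  assumes "pair_wf_digraph G"
  shows "pair_wf_digraph (direct_product (path_graph 2) G)"
proof -
  interpret pair_wf_digraph G by fact
  show ?thesis
    by unfold_locales
      (auto simp: direct_product_def path_graph_def dest: in_arcsD1 in_arcsD2)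
qed

lemma weight_product_path_2:
  "weight (direct_product (path_graph 2) G) f = (\<Sum>v \<in> pverts G. f (0, v) + f (1, v))"
  unfolding weight_def pverts_product_path_2
  by (simp add: sum.cartesian_product' sum.distrib)

lemma rdrd_number_product_path_2_le:
  assumes "pair_wf_digraph G"
  shows "rdrd_number (direct_product (path_graph 2) G) \<le> 2 * rdrd_number G"
proof -
  obtain f where f: "rdrd_function G f" "weight G f = rdrd_number G"
    using rdrd_number_attained by blast
  have "rdrd_function (direct_product (path_graph 2) G) (f \<circ> snd)"
  proof (rule rdrd_function_pullback[OF pair_wf_digraph_product_path_2[OF assms] assms _ _ f(1)])
    fix x
    assume "x \<in> pverts (direct_product (path_graph 2) G)"
    then obtain i v where "x = (i, v)" "i < 2" "v \<in> pverts G"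
      unfolding pverts_product_path_2 by auto
    then show "snd x \<in> pverts G"
      and "bij_betw snd (neighbours (with_proj (direct_product (path_graph 2) G)) x)
        (neighbours (with_proj G) (snd x))"
      by (auto simp: neighbours_product_path_2 bij_betw_def inj_on_def)
  qed
  moreover have "weight (direct_product (path_graph 2) G) (f \<circ> snd) = 2 * weight G f"
    unfolding weight_product_path_2 by (simp add: weight_def sum_distrib_left mult_2)
  ultimately show ?thesis
    using rdrd_number_le f(2) by metis
qed

lemma rdrd_number_product_path_2_ge:
  fixes G :: "'a pair_pre_digraph"
  assumes "pair_graph G" and "without_odd_cycles G"
  shows "2 * rdrd_number G \<le> rdrd_number (direct_product (path_graph 2) G)"
proof -
  interpret pair_graph G by fact
  have wf: "pair_wf_digraph G" ..
  obtain c :: "'a \<Rightarrow> bool" where c: "\<And>u v. (u, v) \<in> parcs G \<Longrightarrow> c u \<noteq> c v"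
    using two_colouring[OF assms] by blast
  \<comment> \<open>the embeddings of \<open>G\<close> as the two halves of the product\<close>
  define \<phi> where "\<phi> b v = (if c v = b then 0 else 1 :: nat, v)" for b v
  obtain f where f: "rdrd_function (direct_product (path_graph 2) G) f"
    "weight (direct_product (path_graph 2) G) f = rdrd_number (direct_product (path_graph 2) G)"
    using rdrd_number_attained by blast
  have "rdrd_function G (f \<circ> \<phi> b)" for b
  proof (rule rdrd_function_pullback[OF wf pair_wf_digraph_product_path_2[OF wf] _ _ f(1)])
    fix v
    assume "v \<in> pverts G"
    then show "\<phi> b v \<in> pverts (direct_product (path_graph 2) G)"
      unfolding pverts_product_path_2 by (auto simp: \<phi>_def)
    have "\<phi> b ` neighbours (with_proj G) v = {1 - fst (\<phi> b v)} \<times> neighbours (with_proj G) v"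
      using c[of v] by (auto simp: \<phi>_def neighbours_with_proj image_iff)
    then show "bij_betw (\<phi> b) (neighbours (with_proj G) v)
        (neighbours (with_proj (direct_product (path_graph 2) G)) (\<phi> b v))"
      by (auto simp: bij_betw_def inj_on_def neighbours_product_path_2 \<phi>_def)
  qed
  then have "rdrd_number G \<le> weight G (f \<circ> \<phi> b)" for b
    by (rule rdrd_number_le)
  then have "2 * rdrd_number G \<le> weight G (f \<circ> \<phi> True) + weight G (f \<circ> \<phi> False)"
    by (metis add_mono mult_2)
  also have "\<dots> = weight (direct_product (path_graph 2) G) f"
    unfolding weight_product_path_2 unfolding weight_def sum.distrib[symmetric]
    by (rule sum.cong) (auto simp: \<phi>_def)
  finally show ?thesis
    using f(2) by simp
qed

section \<open>The strict inequality\<close>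

text \<open>
  Weight 0 is impossible because a vertex of value 0 has a neighbour of positive value.
\<close>
lemma rdrd_number_pos:
  assumes "simple_graph G"
  shows "0 < rdrd_number G"
proof -
  interpret pair_graph G
    using assms by (simp add: simple_graph_def)
  obtain f where f: "rdrd_function G f" "weight G f = rdrd_number G"
    using rdrd_number_attained by blast
  obtain v where v: "v \<in> pverts G"
    using assms by (auto simp: simple_graph_def)
  have "\<exists>u \<in> pverts G. f u \<noteq> 0"
  proof (cases "f v = 0")
    case True
    have "\<exists>u \<in> neighbours (with_proj G) v. f u \<noteq> 0"
      using rdrd_function_zeroD[OF f(1) v True]
    proof
      assume "2 \<le> card {u \<in> neighbours (with_proj G) v. f u = 2}"
      then have "{u \<in> neighbours (with_proj G) v. f u = 2} \<noteq> {}"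
        by (intro notI) simp
      then obtain u where "u \<in> neighbours (with_proj G) v" "f u = 2"
        by blast
      then show ?thesis
        by (intro bexI[of _ u]) simp_all
    next
      assume "\<exists>u \<in> neighbours (with_proj G) v. f u = 3"
      then obtain u where "u \<in> neighbours (with_proj G) v" "f u = 3"
        by blast
      then show ?thesis
        by (intro bexI[of _ u]) simp_all
    qed
    then show ?thesis
      using neighbours_subset_pverts[of G v] pair_wf_digraph by blast
  qed (use v in auto)
  then have "weight G f \<noteq> 0"
    using pair_finite_verts by (simp add: weight_def)
  then show ?thesis
    using f(2) by simp
qed

text \<open>
  A vertex of value 0 would need a neighbour of value 0 and another one of positive value, but the
  vertices of \<open>P\<^sub>2\<close> have degree 1. So both values are positive, and they are not both 1.
\<close>
lemma rdrd_number_path_2_gt: "2 < rdrd_number (path_graph 2)"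
proof -
  obtain f where f: "rdrd_function (path_graph 2) f"
    "weight (path_graph 2) f = rdrd_number (path_graph 2)"
    using rdrd_number_attained by blast
  have wf: "pair_wf_digraph (path_graph 2)"
    by unfold_locales (auto simp: path_graph_def)
  have verts: "pverts (path_graph 2) = {0, 1}"
    by (auto simp: path_graph_def)
  have nbrs: "neighbours (with_proj (path_graph 2)) i = {1 - i}" if "i \<in> {0, 1}" for i
    using that by (auto simp: neighbours_with_proj parcs_path_2)
  have pos: "f i \<noteq> 0" if i: "i \<in> {0, 1}" for i
  proof
    assume "f i = 0"
    have zero: "f (1 - i) = 0"
      using rdrd_function_zero_neighbour[OF wf f(1), of i] i \<open>f i = 0\<close> by (auto simp: verts nbrs)
    then have none: "{u \<in> {1 - i}. f u = 2} = {}"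
      by auto
    have "2 \<le> card {u \<in> {1 - i}. f u = 2} \<or> (\<exists>u \<in> {1 - i}. f u = 3)"
      using rdrd_function_zeroD[OF f(1), of i] i \<open>f i = 0\<close> unfolding verts nbrs[OF i] by blast
    then show False
      unfolding none using zero by simp
  qed
  have "2 \<le> f 1" if "f 0 = 1"
    using rdrd_function_oneD[OF f(1), of 0] that by (simp add: verts nbrs)
  then have "2 < f 0 + f 1"
    using pos[of 0] pos[of 1] by (cases "f 0 = 1") auto
  then show ?thesis
    using f(2) by (simp add: weight_def verts)
qed

lemma rdrd_number_product_path_2:
  assumes "simple_graph G" and "without_odd_cycles G"
  shows "rdrd_number (direct_product (path_graph 2) G) = 2 * rdrd_number G"
    and "2 * rdrd_number G < rdrd_number (path_graph 2) * rdrd_number G"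
proof -
  interpret pair_graph G
    using assms(1) by (simp add: simple_graph_def)
  show "rdrd_number (direct_product (path_graph 2) G) = 2 * rdrd_number G"
    using rdrd_number_product_path_2_le[OF pair_wf_digraph]
      rdrd_number_product_path_2_ge[OF pair_graph assms(2)]
    by (rule antisym)
  show "2 * rdrd_number G < rdrd_number (path_graph 2) * rdrd_number G"
    using rdrd_number_path_2_gt rdrd_number_pos[OF assms(1)] by simp
qed

theorem theorem4p3:
  fixes T :: "'a pair_pre_digraph" and G :: "'b pair_pre_digraph"
  assumes "undirected_tree T"
    and "simple_graph G" and "without_odd_cycles G"
  shows "(rdrd_number (direct_product (path_graph 2) T) = 2 * rdrd_number T \<and>
          2 * rdrd_number T < rdrd_number (path_graph 2) * rdrd_number T) \<and>
         (rdrd_number (direct_product (path_graph 2) G) = 2 * rdrd_number G \<and>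
          2 * rdrd_number G < rdrd_number (path_graph 2) * rdrd_number G)"
proof -
  have T: "simple_graph T" "without_odd_cycles T"
    using assms(1) unfolding undirected_tree_def without_odd_cycles_def by blast+
  show ?thesis
    by (intro conjI rdrd_number_product_path_2 T assms)
qed

end
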